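(* Let $T:V\to\mathfrak g$ be a relative Rota-Baxter operator on an $n$-LieRep pair $(\mathfrak g,[-,\cdots,-]_{\mathfrak g};\rho)$. Then there exists an $n$-pre-Lie algebra structure on $V$ given by $$\{u_1,\cdots,u_n\}_T=\rho(Tu_1,\cdots,Tu_{n-1})(u_n),\qquad\forall\,u_1,\cdots,u_n\in V.$$ Furthermore, $(V,[-,\cdots,-]_T)$ is the sub-adjacent $n$-Lie algebra of the $n$-pre-Lie algebra $(V,\{-,\cdots,-\}_T)$, where the bracket $[-,\cdots,-]_T:\wedge^nV\to V$ is given by $$[u_1,\cdots,u_n]_T=\sum_{i=1}^n(-1)^{n-i}\rho(Tu_1,\cdots,\widehat{Tu_i},\cdots,Tu_n)(u_i),$$ and $T$ is an $n$-Lie algebra morphism from $(V,[-,\cdots,-]_T)$ to $(\mathfrak g,[-,\cdots,-]_{\mathfrak g})$.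
   Context: All vector spaces are finite dimensional over an algebraically closed field of characteristic $0$; $n\ge2$; a hat denotes omission. An $n$-Lie algebra is a vector space $\mathfrak g$ with a skew-symmetric linear map $[-,\cdots,-]_{\mathfrak g}:\wedge^n\mathfrak g\to\mathfrak g$ such that $[x_1,\cdots,x_{n-1},[y_1,\cdots,y_n]]=\sum_{i=1}^n[y_1,\cdots,y_{i-1},[x_1,\cdots,x_{n-1},y_i],y_{i+1},\cdots,y_n]$. A representation of it on $V$ is a linear map $\rho:\wedge^{n-1}\mathfrak g\to\mathfrak{gl}(V)$ with (i) $[\rho(\mathfrak X),\rho(\mathfrak Y)]=\rho(\mathfrak X\circ\mathfrak Y)$ (commutator on the left), where for $\mathfrak X=x_1\wedge\cdots\wedge x_{n-1}$, $\mathfrak Y=y_1\wedge\cdots\wedge y_{n-1}$, $\mathfrak X\circ\mathfrak Y=\sum_{i=1}^{n-1}y_1\wedge\cdots\wedge[x_1,\cdots,x_{n-1},y_i]_{\mathfrak g}\wedge\cdots\wedge y_{n-1}$; and (ii) $\rho(x_1,\cdots,x_{n-2},[y_1,\cdots,y_n]_{\mathfrak g})=\sum_{i=1}^n(-1)^{n-i}\rho(y_1,\cdots,\widehat{y_i},\cdots,y_n)\rho(x_1,\cdots,x_{n-2},y_i)$. An $n$-LieRep pair $(\mathfrak g,[-,\cdots,-]_{\mathfrak g};\rho)$ is an $n$-Lie algebra together with a representation $\rho$ on a vector space $V$. A relative Rota-Baxter operator on it is a linear map $T:V\to\mathfrak g$ with $[Tv_1,\cdots,Tv_n]_{\mathfrak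 g}=\sum_{i=1}^n(-1)^{n-i}T(\rho(Tv_1,\cdots,\widehat{Tv_i},\cdots,Tv_n)(v_i))$ for all $v_i\in V$. An $n$-pre-Lie algebra is a vector space $A$ with a multilinear map $\{-,\cdots,-\}:\wedge^{n-1}A\otimes A\to A$ such that for all $x_i,y_j\in A$: (1) $\{x_1,\cdots,x_{n-1},\{y_1,\cdots,y_{n-1},y_n\}\}=\sum_{i=1}^{n-1}\{y_1,\cdots,y_{i-1},[x_1,\cdots,x_{n-1},y_i]_C,y_{i+1},\cdots,y_n\}+\{y_1,\cdots,y_{n-1},\{x_1,\cdots,x_{n-1},y_n\}\}$; (2) $\{[y_1,\cdots,y_n]_C,x_1,\cdots,x_{n-2},x_{n-1}\}=\sum_{i=1}^n(-1)^{n-i}\{y_1,\cdots,\widehat{y_i},\cdots,y_n,\{y_i,x_1,\cdots,x_{n-2},x_{n-1}\}\}$, where $[x_1,\cdots,x_n]_C=\sum_{i=1}^n(-1)^{n-i}\{x_1,\cdots,\widehat{x_i},\cdots,x_n,x_i\}$. The sub-adjacent $n$-Lie algebra of $(A,\{-,\cdots,-\})$ is $(A,[-,\cdots,-]_C)$. An $n$-Lie algebra morphism is a linear map preserving the $n$-brackets. *)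

theory Defs
  imports "HOL-Computational_Algebra.Polynomial"
begin

text \<open>
  An \<open>n\<close>-ary operation is a function on lists, of which only the values on lists of length \<open>n\<close>
  are constrained. Positions are counted from \<open>0\<close>, so the sign \<open>(-1)^(n-i)\<close> attached to the
  \<open>i\<close>-th argument (\<open>1 \<le> i \<le> n\<close>) appears below as \<open>(-1) ^ (n - Suc i)\<close> with \<open>i < n\<close>.
  Vector spaces are carried by whole types, with an explicit scalar multiplication.
\<close>

locale fin_dim_space = vector_space scale
  for scale :: "'k::field \<Rightarrow> 'v::ab_group_add \<Rightarrow> 'v" +
  assumes fin_dim: "\<exists>B. finite_dimensional_vector_space scale B"

definition omit :: "nat \<Rightarrow> 'a list \<Rightarrow> 'a list" where
  "omit i xs = take i xs @ drop (Suc i) xs"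

definition multilinear_map ::
  "nat \<Rightarrow> ('k::field \<Rightarrow> 'v::ab_group_add \<Rightarrow> 'v) \<Rightarrow> ('k \<Rightarrow> 'w::ab_group_add \<Rightarrow> 'w)
     \<Rightarrow> ('v list \<Rightarrow> 'w) \<Rightarrow> bool" where
  "multilinear_map n s1 s2 f \<longleftrightarrow>
     (\<forall>xs i. length xs = n \<longrightarrow> i < n \<longrightarrow> Vector_Spaces.linear s1 s2 (\<lambda>y. f (xs[i := y])))"

text \<open>
  Linear maps out of an \<open>n\<close>-th exterior power are identified with \<open>n\<close>-linear maps alternating in
  all arguments; a map out of \<open>\<And>\<^sup>m V \<otimes> V\<close> is alternating in its first \<open>m\<close> arguments only.
\<close>

definition alternating_first :: "nat \<Rightarrow> nat \<Rightarrow> ('v list \<Rightarrow> 'w::zero) \<Rightarrow> bool" where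
  "alternating_first m n f \<longleftrightarrow>
     (\<forall>xs i j. length xs = n \<longrightarrow> i < j \<longrightarrow> j < m \<longrightarrow> xs ! i = xs ! j \<longrightarrow> f xs = 0)"

locale n_Lie_algebra = fin_dim_space scale
  for n :: nat
    and scale :: "'k::field \<Rightarrow> 'g::ab_group_add \<Rightarrow> 'g"
    and br :: "'g list \<Rightarrow> 'g" +
  assumes n_ge_2: "2 \<le> n"
    and br_multilinear: "multilinear_map n scale scale br"
    and br_alternating: "alternating_first n n br"
    and fundamental_identity:
      "\<lbrakk>length xs = n - 1; length ys = n\<rbrakk> \<Longrightarrow>
        br (xs @ [br ys]) = (\<Sum>i<n. br (ys[i := br (xs @ [ys ! i])]))"

text \<open>
  The vector space structure of \<open>gl(V)\<close> is pointwise, so multilinearity and alternation of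
  \<open>rho\<close> are stated after evaluation at an arbitrary vector.
\<close>

locale n_LieRep_pair = n_Lie_algebra n sg br + V: fin_dim_space sV
  for n :: nat
    and sg :: "'k::field \<Rightarrow> 'g::ab_group_add \<Rightarrow> 'g"
    and br :: "'g list \<Rightarrow> 'g"
    and sV :: "'k \<Rightarrow> 'v::ab_group_add \<Rightarrow> 'v"
    and rho :: "'g list \<Rightarrow> 'v \<Rightarrow> 'v" +
  assumes rho_endomorphism: "length xs = n - 1 \<Longrightarrow> Vector_Spaces.linear sV sV (rho xs)"
    and rho_multilinear: "multilinear_map (n - 1) sg sV (\<lambda>xs. rho xs v)"
    and rho_alternating: "alternating_first (n - 1) (n - 1) (\<lambda>xs. rho xs v)"
    and rho_commutator:
      "\<lbrakk>length xs = n - 1; length ys = n - 1\<rbrakk> \<Longrightarrow>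
        rho xs (rho ys v) - rho ys (rho xs v) =
          (\<Sum>i<n - 1. rho (ys[i := br (xs @ [ys ! i])]) v)"
    and rho_bracket:
      "\<lbrakk>length xs = n - 2; length ys = n\<rbrakk> \<Longrightarrow>
        rho (xs @ [br ys]) v =
          (\<Sum>i<n. sV ((- 1) ^ (n - Suc i)) (rho (omit i ys) (rho (xs @ [ys ! i]) v)))"

locale relative_Rota_Baxter = n_LieRep_pair n sg br sV rho
  for n :: nat
    and sg :: "'k::field \<Rightarrow> 'g::ab_group_add \<Rightarrow> 'g"
    and br :: "'g list \<Rightarrow> 'g"
    and sV :: "'k \<Rightarrow> 'v::ab_group_add \<Rightarrow> 'v"
    and rho :: "'g list \<Rightarrow> 'v \<Rightarrow> 'v"
    and T :: "'v \<Rightarrow> 'g" +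
  assumes T_linear: "Vector_Spaces.linear sV sg T"
    and T_Rota_Baxter:
      "length vs = n \<Longrightarrow>
        br (map T vs) =
          (\<Sum>i<n. sg ((- 1) ^ (n - Suc i)) (T (rho (map T (omit i vs)) (vs ! i))))"

definition sub_adjacent_bracket ::
  "nat \<Rightarrow> ('k::field \<Rightarrow> 'a::ab_group_add \<Rightarrow> 'a) \<Rightarrow> ('a list \<Rightarrow> 'a) \<Rightarrow> 'a list \<Rightarrow> 'a" where
  "sub_adjacent_bracket n scale p xs =
     (\<Sum>i<n. scale ((- 1) ^ (n - Suc i)) (p (omit i xs @ [xs ! i])))"

locale n_pre_Lie_algebra = fin_dim_space scale
  for n :: nat
    and scale :: "'k::field \<Rightarrow> 'a::ab_group_add \<Rightarrow> 'a"
    and p :: "'a list \<Rightarrow> 'a" +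
  assumes n_ge_2: "2 \<le> n"
    and p_multilinear: "multilinear_map n scale scale p"
    and p_alternating: "alternating_first (n - 1) n p"
    and p_derivation:
      "\<lbrakk>length xs = n - 1; length ys = n - 1\<rbrakk> \<Longrightarrow>
        p (xs @ [p (ys @ [z])]) =
          (\<Sum>i<n - 1. p (ys[i := sub_adjacent_bracket n scale p (xs @ [ys ! i])] @ [z]))
          + p (ys @ [p (xs @ [z])])"
    and p_bracket:
      "\<lbrakk>length xs = n - 1; length ys = n\<rbrakk> \<Longrightarrow>
        p (sub_adjacent_bracket n scale p ys # xs) =
          (\<Sum>i<n. scale ((- 1) ^ (n - Suc i)) (p (omit i ys @ [p (ys ! i # xs)])))"

locale n_Lie_morphism =
  dom: n_Lie_algebra n s1 br1 + cod: n_Lie_algebra n s2 br2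
  for n :: nat
    and s1 :: "'k::field \<Rightarrow> 'g::ab_group_add \<Rightarrow> 'g"
    and br1 :: "'g list \<Rightarrow> 'g"
    and s2 :: "'k \<Rightarrow> 'h::ab_group_add \<Rightarrow> 'h"
    and br2 :: "'h list \<Rightarrow> 'h"
    and f :: "'g \<Rightarrow> 'h" +
  assumes f_linear: "Vector_Spaces.linear s1 s2 f"
    and f_bracket: "length xs = n \<Longrightarrow> f (br1 xs) = br2 (map f xs)"

definition induced_product ::
  "('g list \<Rightarrow> 'v \<Rightarrow> 'v) \<Rightarrow> ('v \<Rightarrow> 'g) \<Rightarrow> 'v list \<Rightarrow> 'v" where
  "induced_product rho T us = rho (map T (butlast us)) (last us)"

definition induced_bracket ::
  "nat \<Rightarrow> ('k::field \<Rightarrow> 'v::ab_group_add \<Rightarrow> 'v) \<Rightarrow> ('g list \<Rightarrow> 'v \<Rightarrow> 'v) \<Rightarrow> ('v \<Rightarrow> 'g)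
     \<Rightarrow> 'v list \<Rightarrow> 'v" where
  "induced_bracket n sV rho T us =
     (\<Sum>i<n. sV ((- 1) ^ (n - Suc i)) (rho (map T (omit i us)) (us ! i)))"

end

theory Submission
  imports Defs
begin

text \<open>
  Substituting \<open>T\<close> into the arguments of \<open>\<rho>\<close> turns the axioms of a representation into those of an
  \<open>n\<close>-pre-Lie algebra. The Rota-Baxter identity says precisely that \<open>T\<close> sends the sub-adjacent
  bracket \<open>[u\<^sub>1,\<dots>,u\<^sub>n]\<^sub>C\<close> of the product \<open>\<rho>(Tu\<^sub>1,\<dots>,Tu\<^bsub>n-1\<^esub>)(u\<^sub>n)\<close> to \<open>[Tu\<^sub>1,\<dots>,Tu\<^sub>n]\<close>, so
  \<open>T\<close> is a morphism. Once the brackets of elements \<open>Tu\<^sub>i\<close> are rewritten in this way, the commutator rule for \<open>\<rho>\<close> becomes the first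
  pre-Lie identity, and the rule for \<open>\<rho>\<close> at a bracket becomes the second one; in the second, the
  bracket has to travel from the last argument of \<open>\<rho>\<close> to the first, but both sides acquire the same
  sign \<open>(-1)\<^bsup>n-2\<^esup>\<close>. This is \<open>induced_n_pre_Lie_algebra\<close>.

  What remains does not involve \<open>T\<close>: the sub-adjacent bracket of any \<open>n\<close>-pre-Lie algebra is an
  \<open>n\<close>-Lie bracket (\<open>sub_adjacent_n_Lie_algebra\<close>). It is alternating because, when two arguments
  agree, each summand vanishes except the two that single out one of the equal arguments, and
  these two cancel: they differ by moving the other copy past the block in between
  (\<open>move_past_block\<close>). For the fundamental identity, every bracket is split according to the argument
  that it singles out. On the right-hand side, the derivation rule collects all terms in which the
  singled-out argument is not the one that was bracketed. The left-hand side is brought to the same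
  form by the second pre-Lie identity.
\<close>

section \<open>Omitting an entry of a list\<close>

lemma length_omit [simp]: "i < length xs \<Longrightarrow> length (omit i xs) = length xs - 1"
  by (simp add: omit_def)

lemma map_omit: "map f (omit i xs) = omit i (map f xs)"
  by (simp add: omit_def take_map drop_map)

lemma omit_append: "i < length xs \<Longrightarrow> omit i (xs @ ys) = omit i xs @ ys"
  by (simp add: omit_def)

lemma omit_length_append [simp]: "omit (length xs) (xs @ y # ys) = xs @ ys"
  by (simp add: omit_def)

lemma omit_update_same [simp]: "omit i (xs[i := y]) = omit i xs"
  by (simp add: omit_def)

text \<open>
  The order-preserving enumeration of the indices different from \<open>i\<close>: position \<open>k\<close> of a list with
  entry \<open>i\<close> removed is position \<open>skip i k\<close> of the original list.
\<close>

definition skip :: "nat \<Rightarrow> nat \<Rightarrow> nat" where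
  "skip i k = (if k < i then k else Suc k)"

lemma nth_omit:
  "\<lbrakk>i < length xs; k < length xs - 1\<rbrakk> \<Longrightarrow> omit i xs ! k = xs ! skip i k"
  by (auto simp: omit_def skip_def nth_append min_def)

lemma update_omit:
  assumes "i < length xs" "k < length xs - 1"
  shows "(omit i xs)[k := y] = omit i (xs[skip i k := y])"
proof (rule nth_equalityI)
  have s: "skip i k < length xs" using assms by (auto simp: skip_def)
  show "length ((omit i xs)[k := y]) = length (omit i (xs[skip i k := y]))"
    using assms by simp
  fix l assume "l < length ((omit i xs)[k := y])"
  then have l: "l < length xs - 1" using assms by simp
  have "skip i k = skip i l \<longleftrightarrow> k = l" by (auto simp: skip_def)
  then show "(omit i xs)[k := y] ! l = omit i (xs[skip i k := y]) ! l"
    using assms l s by (simp add: nth_omit nth_list_update)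
qed

lemma bij_betw_skip:
  assumes "i < n"
  shows "bij_betw (skip i) {..<n - 1} ({..<n} - {i})"
proof (rule bij_betw_byWitness[where f' = "\<lambda>k. if k < i then k else k - 1"])
qed (use assms in \<open>auto simp: skip_def split: if_splits\<close>)

lemma skip_cases:
  assumes "i < n" "j < n" "j \<noteq> i"
  obtains k where "k < n - 1" "skip i k = j"
proof -
  have "j \<in> skip i ` {..<n - 1}"
    using bij_betw_imp_surj_on[OF bij_betw_skip[OF assms(1)]] assms by simp
  then show thesis using that by auto
qed

section \<open>Multilinear and alternating operations\<close>

lemma linear_sum_compose:
  assumes "Vector_Spaces.linear s1 s2 f"
  shows "f (\<Sum>i\<in>I. s1 (c i) (g i)) = (\<Sum>i\<in>I. s2 (c i) (f (g i)))"
proof -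
  interpret f: Vector_Spaces.linear s1 s2 f by (fact assms)
  show ?thesis by (simp add: f.sum f.scale)
qed

lemma linear_scaled_sum:
  assumes "vector_space s1" "vector_space s2"
    and "\<And>i. i \<in> I \<Longrightarrow> Vector_Spaces.linear s1 s2 (g i)"
  shows "Vector_Spaces.linear s1 s2 (\<lambda>x. \<Sum>i\<in>I. s2 (c i) (g i x))"
proof -
  interpret A: vector_space s1 by fact
  interpret B: vector_space s2 by fact
  show ?thesis using assms(3)
    by (simp add: Vector_Spaces.linear_iff assms(1,2) B.scale_right_distrib sum.distrib
        B.scale_sum_right mult.commute)
qed

text \<open>
  Polarization: in \<open>f(\<dots>, x + y, x + y, \<dots>) = 0\<close> only the two mixed terms survive the expansion.
\<close>

lemma adjacent_swap:
  assumes ml: "multilinear_map n s1 s2 f" and alt: "alternating_first m n f"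
    and len: "length (as @ [x, y] @ cs) = n" "length as + 1 < m"
  shows "f (as @ [y, x] @ cs) = - f (as @ [x, y] @ cs)"
proof -
  have lin: "Vector_Spaces.linear s1 s2 (\<lambda>u. f (as @ u # b # cs))"
       "Vector_Spaces.linear s1 s2 (\<lambda>u. f (as @ b # u # cs))" for b
    using ml[unfolded multilinear_map_def, rule_format, of "as @ [x, b] @ cs" "length as"]
      ml[unfolded multilinear_map_def, rule_format, of "as @ [b, x] @ cs" "Suc (length as)"] len
    by (simp_all add: list_update_append)
  have zero: "f (as @ u # u # cs) = 0" for u
    using alt[unfolded alternating_first_def, rule_format,
        of "as @ [u, u] @ cs" "length as" "Suc (length as)"] len
    by (simp add: nth_append)
  have add1: "f (as @ (a + a') # b # cs) = f (as @ a # b # cs) + f (as @ a' # b # cs)" for a a' b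
    using lin(1)[of b] by (simp add: Vector_Spaces.linear_iff)
  have add2: "f (as @ b # (a + a') # cs) = f (as @ b # a # cs) + f (as @ b # a' # cs)" for a a' b
    using lin(2)[of b] by (simp add: Vector_Spaces.linear_iff)
  have "0 = f (as @ (x + y) # (x + y) # cs)" by (simp add: zero)
  also have "\<dots> = f (as @ x # y # cs) + f (as @ y # x # cs)"
    unfolding add1 add2 by (simp add: zero)
  finally show ?thesis by (simp add: eq_neg_iff_add_eq_0 add.commute)
qed

text \<open>
  Each entry of the block contributes one adjacent swap. Only the first \<open>m\<close> arguments are
  interchangeable, so the trailing part \<open>cs\<close> may contain arguments in which \<open>f\<close> is merely linear.
\<close>

lemma move_past_block:
  assumes ml: "multilinear_map n s1 s2 f" and alt: "alternating_first m n f"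
    and vs: "vector_space s2"
    and "length (as @ x # bs @ cs) = n" "length as + length bs < m"
  shows "f (as @ bs @ x # cs) = s2 ((- 1) ^ length bs) (f (as @ x # bs @ cs))"
  using assms(4,5)
proof (induction bs arbitrary: as)
  case Nil
  interpret vector_space s2 by (fact vs)
  show ?case by simp
next
  case (Cons b bs)
  interpret vector_space s2 by (fact vs)
  have "f (as @ (b # bs) @ x # cs) = s2 ((- 1) ^ length bs) (f (as @ b # x # bs @ cs))"
    using Cons.IH[of "as @ [b]"] Cons.prems by simp
  also have "f (as @ b # x # bs @ cs) = - f (as @ x # b # bs @ cs)"
    using adjacent_swap[OF ml alt, of as x b "bs @ cs"] Cons.prems by simp
  finally show ?case by simp
qed

section \<open>The sub-adjacent n-Lie algebra\<close>

context n_pre_Lie_algebra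
begin

abbreviation bracket_C :: "'a list \<Rightarrow> 'a" where
  "bracket_C \<equiv> sub_adjacent_bracket n scale p"

lemma p_linear_last:
  assumes "length xs = n - 1"
  shows "Vector_Spaces.linear scale scale (\<lambda>z. p (xs @ [z]))"
  using p_multilinear[unfolded multilinear_map_def, rule_format, of "xs @ [undefined]" "n - 1"]
    assms n_ge_2 by (simp add: list_update_append)

lemma bracket_C_multilinear: "multilinear_map n scale scale bracket_C"
  unfolding multilinear_map_def
proof (intro allI impI)
  fix xs :: "'a list" and i assume len: "length xs = n" and i: "i < n"
  have "Vector_Spaces.linear scale scale (\<lambda>y. p (omit k (xs[i := y]) @ [xs[i := y] ! k]))"
    if k: "k < n" for k
  proof (cases "k = i")
    case True
    then show ?thesis using p_linear_last[of "omit k xs"] len k by simp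
  next
    case False
    then obtain l where l: "l < n - 1" "skip k l = i" using skip_cases[OF k i] by metis
    have "(\<lambda>y. p (omit k (xs[i := y]) @ [xs[i := y] ! k]))
        = (\<lambda>y. p ((omit k xs @ [xs ! k])[l := y]))"
      using l k len False by (auto simp: update_omit list_update_append)
    then show ?thesis
      using p_multilinear[unfolded multilinear_map_def] l k len by simp
  qed
  then show "Vector_Spaces.linear scale scale (\<lambda>y. bracket_C (xs[i := y]))"
    unfolding sub_adjacent_bracket_def
    by (intro linear_scaled_sum vector_space_axioms) auto
qed

text \<open>
  Write the arguments as \<open>as, x, bs, x, cs\<close>. Singling out a third argument leaves both copies of \<open>x\<close>
  among the alternating arguments of \<open>p\<close>. Singling out the first or the second \<open>x\<close> leaves
  \<open>as, bs, x, cs\<close> or \<open>as, x, bs, cs\<close>; these products differ by \<open>(-1)\<^bsup>|bs|\<^esup>\<close>, whereas the signs attached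
  to the two summands differ by \<open>(-1)\<^bsup>|bs|+1\<^esup>\<close>.
\<close>

lemma bracket_C_alternating: "alternating_first n n bracket_C"
  unfolding alternating_first_def
proof (intro allI impI)
  fix us :: "'a list" and i j
  assume len: "length us = n" and ij: "i < j" and j: "j < n" and eq: "us ! i = us ! j"
  define as bs cs x where "as = take i us" and "bs = take (j - Suc i) (drop (Suc i) us)"
    and "cs = drop (Suc j) us" and "x = us ! i"
  have us: "us = as @ x # bs @ x # cs"
  proof -
    have "drop (Suc i) us = bs @ drop (j - Suc i) (drop (Suc i) us)"
      unfolding bs_def by (rule append_take_drop_id[symmetric])
    also have "drop (j - Suc i) (drop (Suc i) us) = drop j us" using ij by simp
    also have "\<dots> = x # cs" using j len eq by (simp add: Cons_nth_drop_Suc x_def cs_def)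
    finally show ?thesis
      using id_take_nth_drop[of i us] ij j len by (simp add: as_def x_def)
  qed
  have la: "length as = i" and lb: "length bs = j - Suc i"
    using ij j len by (auto simp: as_def bs_def)
  have oi: "omit i us = as @ bs @ x # cs"
    using omit_length_append[of as x "bs @ x # cs"] la us by simp
  have oj: "omit j us = as @ x # bs @ cs"
    using omit_length_append[of "as @ x # bs" x cs] la lb ij us by simp
  define t where "t k = scale ((- 1) ^ (n - Suc k)) (p (omit k us @ [us ! k]))" for k
  have "t k = 0" if k: "k < n" "k \<noteq> i" "k \<noteq> j" for k
  proof -
    obtain i' where i': "i' < n - 1" "skip k i' = i"
      by (rule skip_cases[of k n i]) (use k ij j in auto)
    obtain j' where j': "j' < n - 1" "skip k j' = j"
      by (rule skip_cases[of k n j]) (use k j in auto)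
    have "i' < j'" using i' j' ij by (auto simp: skip_def split: if_splits)
    moreover have "(omit k us @ [us ! k]) ! i' = (omit k us @ [us ! k]) ! j'"
      using i' j' k len eq by (simp add: nth_append nth_omit)
    ultimately have "p (omit k us @ [us ! k]) = 0"
      using p_alternating[unfolded alternating_first_def, rule_format, of "omit k us @ [us ! k]" i' j']
        len k j'(1) n_ge_2 by simp
    then show ?thesis by (simp add: t_def)
  qed
  then have "bracket_C us = (\<Sum>k\<in>{i, j}. t k)"
    unfolding sub_adjacent_bracket_def t_def using ij j by (intro sum.mono_neutral_right) auto
  also have "\<dots> = t i + t j" using ij by simp
  also have "t i = - t j"
  proof -
    have "length as + Suc (length bs) + Suc (length cs) = n" using len us by simp
    then have "p (as @ bs @ x # cs @ [x])
        = scale ((- 1) ^ length bs) (p (as @ x # bs @ cs @ [x]))"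
      by (intro move_past_block[OF p_multilinear p_alternating vector_space_axioms]) auto
    moreover have "us ! j = x" "us ! i = x" using eq by (auto simp: x_def)
    ultimately have "t i = scale ((- 1) ^ (n - Suc i + length bs)) (p (omit j us @ [x]))"
      by (simp add: t_def oi oj power_add)
    \<comment> \<open>The summand \<open>2 * length bs\<close> does not affect the sign, so the two exponents differ in parity.\<close>
    also have "n - Suc i + length bs = Suc (n - Suc j + 2 * length bs)"
      using lb ij j by simp
    finally show ?thesis
      using \<open>us ! j = x\<close> by (simp add: t_def power_add power_mult)
  qed
  finally show "bracket_C us = 0" by simp
qed

text \<open>
  The second pre-Lie identity with the bracket in the last alternating position. This is the form
  in which it meets the fundamental identity, where the bracket is the last argument and the
  singled-out argument is put behind it.
\<close>

lemma p_bracket_penultimate: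
  assumes xs: "length xs = n - 2" and ys: "length ys = n"
  shows "p (xs @ [bracket_C ys, z]) =
    (\<Sum>i<n. scale ((- 1) ^ (n - Suc i)) (p (omit i ys @ [p (xs @ [ys ! i, z])])))"
proof -
  have front: "p (xs @ [b, z]) = scale ((- 1) ^ (n - 2)) (p (b # xs @ [z]))" for b
    using move_past_block[OF p_multilinear p_alternating vector_space_axioms, of "[]" b xs "[z]"]
      xs n_ge_2 by simp
  have "p (xs @ [bracket_C ys, z]) = (\<Sum>i<n. scale ((- 1) ^ (n - Suc i))
      (scale ((- 1) ^ (n - 2)) (p (omit i ys @ [p (ys ! i # xs @ [z])]))))"
    using p_bracket[of "xs @ [z]" ys] xs ys n_ge_2
    by (simp add: front scale_sum_right mult.commute[of "(- 1) ^ (n - 2)"])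
  also have "\<dots> = (\<Sum>i<n. scale ((- 1) ^ (n - Suc i)) (p (omit i ys @ [p (xs @ [ys ! i, z])])))"
  proof (rule sum.cong[OF refl])
    fix i assume "i \<in> {..<n}"
    then interpret l: Vector_Spaces.linear scale scale "\<lambda>z. p (omit i ys @ [z])"
      using p_linear_last[of "omit i ys"] ys by simp
    show "scale ((- 1) ^ (n - Suc i))
        (scale ((- 1) ^ (n - 2)) (p (omit i ys @ [p (ys ! i # xs @ [z])])))
      = scale ((- 1) ^ (n - Suc i)) (p (omit i ys @ [p (xs @ [ys ! i, z])]))"
      by (simp add: front l.scale del: scale_scale)
  qed
  finally show ?thesis .
qed

lemma bracket_C_append_one:
  assumes "length xs = n - 1"
  shows "bracket_C (xs @ [z]) =
    (\<Sum>l<n - 1. scale ((- 1) ^ (n - Suc l)) (p (omit l xs @ [z, xs ! l]))) + p (xs @ [z])"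
proof -
  obtain m where m: "n = Suc m" using n_ge_2 by (cases n) auto
  have "omit m (xs @ [z]) = xs" using omit_length_append[of xs z "[]"] assms m by simp
  then show ?thesis
    using assms unfolding sub_adjacent_bracket_def m by (simp add: omit_append nth_append)
qed

text \<open>
  Let \<open>R\<^sub>i = [xs, y\<^sub>i]\<^sub>C - {xs, y\<^sub>i}\<close>, the part of the bracket in which one of the \<open>xs\<close> is singled out. In
  the summands of the right-hand side that single out position \<open>i\<close> of \<open>ys\<close>, the entry at \<open>i\<close> itself
  may be the one that was bracketed, or the bracketed entry lies among the remaining entries. The
  derivation rule evaluates the sum over the latter, and its correction term turns \<open>[xs, y\<^sub>i]\<^sub>C\<close> in the
  former into \<open>R\<^sub>i\<close>. The terms \<open>{xs, {\<dots>, y\<^sub>i}}\<close> then add up to \<open>{xs, [ys]\<^sub>C}\<close>, and the terms in \<open>R\<^sub>i\<close> are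
  those obtained from expanding \<open>[ys]\<^sub>C\<close> in the other summands of \<open>[xs, [ys]\<^sub>C]\<^sub>C\<close>.
\<close>

lemma bracket_C_fundamental_identity:
  assumes xs: "length xs = n - 1" and ys: "length ys = n"
  shows "bracket_C (xs @ [bracket_C ys]) = (\<Sum>i<n. bracket_C (ys[i := bracket_C (xs @ [ys ! i])]))"
proof -
  let ?s = "\<lambda>i. scale ((- 1) ^ (n - Suc i))"
  let ?B = "\<lambda>i. bracket_C (xs @ [ys ! i])"
  let ?R = "\<lambda>i. \<Sum>l<n - 1. ?s l (p (omit l xs @ [ys ! i, xs ! l]))"
  have len: "length (omit i ys) = n - 1" if "i < n" for i using that ys by simp
  have row: "(\<Sum>j<n. p (omit i (ys[j := ?B j]) @ [ys[j := ?B j] ! i]))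
      = p (omit i ys @ [?R i]) + p (xs @ [p (omit i ys @ [ys ! i])])" if i: "i < n" for i
  proof -
    have "(\<Sum>j<n. p (omit i (ys[j := ?B j]) @ [ys[j := ?B j] ! i]))
       = p (omit i ys @ [?B i]) + (\<Sum>j\<in>{..<n} - {i}. p (omit i (ys[j := ?B j]) @ [ys ! i]))"
      using i ys by (subst sum.remove[of _ i]) auto
    also have "(\<Sum>j\<in>{..<n} - {i}. p (omit i (ys[j := ?B j]) @ [ys ! i]))
       = (\<Sum>k<n - 1. p (omit i (ys[skip i k := ?B (skip i k)]) @ [ys ! i]))"
      by (rule sum.reindex_bij_betw[OF bij_betw_skip[OF i], symmetric])
    also have "\<dots> = (\<Sum>k<n - 1. p ((omit i ys)[k := bracket_C (xs @ [omit i ys ! k])] @ [ys ! i]))"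
      using i ys by (intro sum.cong refl) (simp add: update_omit nth_omit)
    also have "\<dots> = p (xs @ [p (omit i ys @ [ys ! i])]) - p (omit i ys @ [p (xs @ [ys ! i])])"
      using p_derivation[OF xs len[OF i], of "ys ! i"] by simp
    also have "p (omit i ys @ [?B i]) = p (omit i ys @ [?R i]) + p (omit i ys @ [p (xs @ [ys ! i])])"
      using p_linear_last[OF len[OF i]] unfolding bracket_C_append_one[OF xs]
      by (simp add: Vector_Spaces.linear_iff)
    finally show ?thesis by simp
  qed
  have "(\<Sum>j<n. bracket_C (ys[j := ?B j]))
      = (\<Sum>i<n. ?s i (\<Sum>j<n. p (omit i (ys[j := ?B j]) @ [ys[j := ?B j] ! i])))"
    unfolding sub_adjacent_bracket_def[where xs = "ys[_ := _]"] scale_sum_right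
    by (rule sum.swap)
  also have "\<dots> = (\<Sum>i<n. ?s i (p (omit i ys @ [?R i])))
      + (\<Sum>i<n. ?s i (p (xs @ [p (omit i ys @ [ys ! i])])))"
    by (simp add: row scale_right_distrib sum.distrib)
  also have "(\<Sum>i<n. ?s i (p (xs @ [p (omit i ys @ [ys ! i])]))) = p (xs @ [bracket_C ys])"
    unfolding sub_adjacent_bracket_def[of _ _ _ ys]
    by (rule linear_sum_compose[OF p_linear_last[OF xs], symmetric])
  also have "(\<Sum>i<n. ?s i (p (omit i ys @ [?R i])))
      = (\<Sum>i<n. \<Sum>l<n - 1. ?s l (?s i (p (omit i ys @ [p (omit l xs @ [ys ! i, xs ! l])]))))"
    by (intro sum.cong refl)
      (simp add: linear_sum_compose[OF p_linear_last[OF len]] scale_sum_right mult.commute)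
  also have "\<dots> = (\<Sum>l<n - 1. ?s l (p (omit l xs @ [bracket_C ys, xs ! l])))"
    using xs ys by (subst sum.swap)
      (simp add: p_bracket_penultimate scale_sum_right numeral_2_eq_2)
  finally show ?thesis
    unfolding bracket_C_append_one[OF xs] by simp
qed

theorem sub_adjacent_n_Lie_algebra: "n_Lie_algebra n scale bracket_C"
  by unfold_locales
    (fact n_ge_2 bracket_C_multilinear bracket_C_alternating bracket_C_fundamental_identity)+

end

section \<open>The n-pre-Lie algebra of a relative Rota-Baxter operator\<close>

context relative_Rota_Baxter
begin

abbreviation product_T :: "'v list \<Rightarrow> 'v" where
  "product_T \<equiv> induced_product rho T"

lemma product_T_append_one [simp]: "product_T (us @ [v]) = rho (map T us) v"
  by (simp add: induced_product_def)

lemma induced_bracket_eq_sub_adjacent: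
  "induced_bracket n sV rho T us = sub_adjacent_bracket n sV product_T us"
  by (simp add: induced_bracket_def sub_adjacent_bracket_def)

text \<open>
  The Rota-Baxter identity, with the linear map \<open>T\<close> pulled out of the alternating sum.
\<close>

lemma T_induced_bracket:
  assumes "length us = n"
  shows "T (sub_adjacent_bracket n sV product_T us) = br (map T us)"
  unfolding sub_adjacent_bracket_def T_Rota_Baxter[OF assms]
  by (simp add: linear_sum_compose[OF T_linear])

text \<open>
  Moving the last argument to the front multiplies both sides of the representation identity
  by \<open>(-1)\<^bsup>n-2\<^esup>\<close>, so the identity keeps its form.
\<close>

lemma rho_bracket_first:
  assumes xs: "length xs = n - 2" and ys: "length ys = n"
  shows "rho (br ys # xs) v =
    (\<Sum>i<n. sV ((- 1) ^ (n - Suc i)) (rho (omit i ys) (rho (ys ! i # xs) v)))"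
proof -
  have last: "rho (b # xs) v = sV ((- 1) ^ (n - 2)) (rho (xs @ [b]) v)" for b
    using move_past_block[OF rho_multilinear rho_alternating V.vector_space_axioms,
        of "[]" b xs "[]" v] xs n_ge_2
    by (simp flip: power_add mult_2 power_mult_distrib)
  have "rho (br ys # xs) v = (\<Sum>i<n. sV ((- 1) ^ (n - Suc i))
      (sV ((- 1) ^ (n - 2)) (rho (omit i ys) (rho (xs @ [ys ! i]) v))))"
    by (simp add: last rho_bracket[OF assms] V.scale_sum_right mult.commute[of "(- 1) ^ (n - 2)"])
  also have "\<dots> = (\<Sum>i<n. sV ((- 1) ^ (n - Suc i)) (rho (omit i ys) (rho (ys ! i # xs) v)))"
  proof (rule sum.cong[OF refl])
    fix i assume "i \<in> {..<n}"
    then interpret l: Vector_Spaces.linear sV sV "rho (omit i ys)"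
      using rho_endomorphism[of "omit i ys"] ys by simp
    show "sV ((- 1) ^ (n - Suc i)) (sV ((- 1) ^ (n - 2)) (rho (omit i ys) (rho (xs @ [ys ! i]) v)))
      = sV ((- 1) ^ (n - Suc i)) (rho (omit i ys) (rho (ys ! i # xs) v))"
      by (simp add: last l.scale del: V.scale_scale)
  qed
  finally show ?thesis .
qed

lemma product_T_multilinear: "multilinear_map n sV sV product_T"
  unfolding multilinear_map_def
proof (intro allI impI)
  fix us :: "'v list" and i assume us: "length us = n" and i: "i < n"
  then obtain ws v where wv: "us = ws @ [v]" by (metis append_butlast_last_id not_less0 list.size(3))
  have len: "length (map T ws) = n - 1" using us wv by auto
  show "Vector_Spaces.linear sV sV (\<lambda>y. product_T (us[i := y]))"
  proof (cases "i < n - 1")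
    case True
    have "(\<lambda>y. product_T (us[i := y])) = (\<lambda>x. rho ((map T ws)[i := x]) v) \<circ> T"
      using True len by (auto simp: wv list_update_append map_update)
    moreover have "Vector_Spaces.linear sg sV (\<lambda>x. rho ((map T ws)[i := x]) v)"
      using rho_multilinear[of v] True len by (simp add: multilinear_map_def)
    ultimately show ?thesis using Vector_Spaces.linear_compose[OF T_linear] by simp
  next
    case False
    then have "(\<lambda>y. product_T (us[i := y])) = rho (map T ws)"
      using i us by (auto simp: wv list_update_append)
    then show ?thesis using rho_endomorphism[OF len] by simp
  qed
qed

lemma product_T_alternating: "alternating_first (n - 1) n product_T"
  unfolding alternating_first_def
proof (intro allI impI)
  fix us :: "'v list" and i j
  assume us: "length us = n" and ij: "i < j" "j < n - 1" and eq: "us ! i = us ! j"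
  then have "map T (butlast us) ! i = map T (butlast us) ! j" by (simp add: nth_butlast)
  then show "product_T us = 0"
    using rho_alternating[of "last us"] us ij by (simp add: alternating_first_def induced_product_def)
qed

theorem induced_n_pre_Lie_algebra: "n_pre_Lie_algebra n sV product_T"
proof
  let ?B = "sub_adjacent_bracket n sV product_T"
  show "2 \<le> n" by (fact n_ge_2)
  show "multilinear_map n sV sV product_T" by (fact product_T_multilinear)
  show "alternating_first (n - 1) n product_T" by (fact product_T_alternating)
  fix xs ys :: "'v list"
  assume xs: "length xs = n - 1"
  show "product_T (xs @ [product_T (ys @ [z])])
      = (\<Sum>i<n - 1. product_T (ys[i := ?B (xs @ [ys ! i])] @ [z])) + product_T (ys @ [product_T (xs @ [z])])"
    if ys: "length ys = n - 1" for z
    using rho_commutator[of "map T xs" "map T ys" z] xs ys n_ge_2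
    by (simp add: map_update T_induced_bracket diff_eq_eq)
  show "product_T (?B ys # xs)
      = (\<Sum>i<n. sV ((- 1) ^ (n - Suc i)) (product_T (omit i ys @ [product_T (ys ! i # xs)])))"
    if ys: "length ys = n"
  proof -
    obtain ws v where wv: "xs = ws @ [v]"
      using xs n_ge_2 by (metis append_butlast_last_id diff_is_0_eq list.size(3) not_less_eq_eq numeral_2_eq_2 One_nat_def)
    have cons: "product_T (y # ws @ [v]) = rho (T y # map T ws) v" for y
      using product_T_append_one[of "y # ws" v] by simp
    show ?thesis
      using rho_bracket_first[of "map T ws" "map T ys" v] xs ys
      by (simp add: wv cons T_induced_bracket map_omit numeral_2_eq_2)
  qed
qed

end

theorem proposition3p18:
  fixes n :: nat
    and sg :: "'k::{alg_closed_field, field_char_0} \<Rightarrow> 'g::ab_group_add \<Rightarrow> 'g"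
    and br :: "'g list \<Rightarrow> 'g"
    and sV :: "'k \<Rightarrow> 'v::ab_group_add \<Rightarrow> 'v"
    and rho :: "'g list \<Rightarrow> 'v \<Rightarrow> 'v"
    and T :: "'v \<Rightarrow> 'g"
  assumes "relative_Rota_Baxter n sg br sV rho T"
  shows "n_pre_Lie_algebra n sV (induced_product rho T)
    \<and> n_Lie_algebra n sV (induced_bracket n sV rho T)
    \<and> (\<forall>us. length us = n \<longrightarrow>
          induced_bracket n sV rho T us = sub_adjacent_bracket n sV (induced_product rho T) us)
    \<and> n_Lie_morphism n sV (induced_bracket n sV rho T) sg br T"
proof -
  interpret relative_Rota_Baxter n sg br sV rho T by fact
  interpret P: n_pre_Lie_algebra n sV product_T by (fact induced_n_pre_Lie_algebra)
  have bracket: "induced_bracket n sV rho T = P.bracket_C"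
    by (rule ext) (fact induced_bracket_eq_sub_adjacent)
  have lie: "n_Lie_algebra n sV (induced_bracket n sV rho T)"
    unfolding bracket by (fact P.sub_adjacent_n_Lie_algebra)
  have "n_Lie_morphism n sV (induced_bracket n sV rho T) sg br T"
    by (intro n_Lie_morphism.intro n_Lie_morphism_axioms.intro lie
        n_Lie_algebra_axioms T_linear) (simp add: bracket T_induced_bracket)
  then show ?thesis
    using induced_n_pre_Lie_algebra lie bracket by simp
qed

end
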